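(* Let $d\in\mathbb{N}$ and let $\alpha_m,\beta_m,\gamma_m,\xi_i,A,\tau^{(m)}$ be as in the context. Assume that $\alpha_m\to1$ in probability as $m\to\infty$ and that $$\frac{\gamma_m}{\beta_m}\to\varrho\in[0,\infty)\quad\text{as } m\to\infty .$$ If there exists an $\varepsilon>0$ such that $$\mathbb{E}\,\inf\Big\{t\ge1:\ \sum_{i=1}^t\xi_i\in\varrho A+B^d(0,\varepsilon)\Big\}=\infty,$$ then $$\liminf_{m\to\infty}\mathbb{P}(\tau^{(m)}>j)>0\quad\text{for every } j\in\mathbb{N},$$ and $$\lim_{m\to\infty}\mathbb{E}\tau^{(m)}=\infty .$$
   Context: $B^d(x,r)$ is the open Euclidean ball in $\mathbb{R}^d$ with centre $x$ and radius $r$; for $A_1,A_2\subseteq\mathbb{R}^d$, $A_1+A_2=\{x_1+x_2:x_1\in A_1,x_2\in A_2\}$; $\inf\emptyset=\min\emptyset=\infty$. $\{\alpha_m\}_{m\in\mathbb{N}}$ are positive random variables with finite first two moments, $\{\beta_m\}_{m\in\mathbb{N}}$ are positive constants, $\{\gamma_m\}_{m\in\mathbb{N}}$ are positive real numbers, and $A\subseteq\mathbb{R}^d$ is a measurable set with $B^d(0,\underline r)\subseteq A\subseteq B^d(0,\overline r)$ for some $\underline r,\overline r\in(0,\infty)$. $\{\xi_t\}_{t\in\mathbb{N}}$ are i.i.d. copies of a random vector $\xi$ in $\mathbb{R}^d$; for each $m$, $\{\alpha_{m,t}\}_{t\in\mathbb{N}}$ are i.i.d. copies of $\alpha_m$,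 independent of $\{\xi_t\}_{t\in\mathbb{N}}$. Define $X_0^{(m)}=0$, $X_{t+1}^{(m)}=\alpha_{m,t+1}X_t^{(m)}+\beta_m\xi_{t+1}$ for $t\ge0$, and $\tau^{(m)}=\min\{t\ge1: X_t^{(m)}\in\gamma_mA\}\in\mathbb{N}\cup\{\infty\}$. *)

theory Defs
  imports "HOL-Probability.Probability"
begin

text \<open>
  Copies are indexed by \<open>t \<ge> 1\<close>; the value \<open>Y 0\<close> is irrelevant.
  Measurability of each \<open>Y t\<close> with \<open>t \<ge> 1\<close> is part of \<^const>\<open>prob_space.indep_vars\<close>.
\<close>

definition iid_copies :: "'w measure \<Rightarrow> (nat \<Rightarrow> 'w \<Rightarrow> 'a::topological_space) \<Rightarrow> ('w \<Rightarrow> 'a) \<Rightarrow> bool" where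
  "iid_copies M Y Z \<longleftrightarrow>
     prob_space.indep_vars M (\<lambda>_. borel) Y {1..} \<and>
     (\<forall>t\<ge>1. distr M borel (Y t) = distr M borel Z)"

text \<open>
  Independence of two whole sequences, that is, of the sigma-algebras they generate, each
  sequence being regarded as one random element of the product space over the index set
  \<open>{1..}\<close>. The library constant \<^const>\<open>prob_space.indep_var\<close> would require both sequences
  to take values in the same type.
\<close>

definition indep_sequences ::
  "'w measure \<Rightarrow> (nat \<Rightarrow> 'w \<Rightarrow> 'a::topological_space) \<Rightarrow> (nat \<Rightarrow> 'w \<Rightarrow> 'b::topological_space) \<Rightarrow> bool" where
  "indep_sequences M Y Z \<longleftrightarrow>
     prob_space.indep_set M
       (sets (vimage_algebra (space M) (\<lambda>\<omega>. \<lambda>t\<in>{1..}. Y t \<omega>) (\<Pi>\<^sub>M t\<in>{1..}. borel)))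
       (sets (vimage_algebra (space M) (\<lambda>\<omega>. \<lambda>t\<in>{1..}. Z t \<omega>) (\<Pi>\<^sub>M t\<in>{1..}. borel)))"

definition converges_in_probability ::
  "'w measure \<Rightarrow> (nat \<Rightarrow> 'w \<Rightarrow> 'a::metric_space) \<Rightarrow> ('w \<Rightarrow> 'a) \<Rightarrow> bool" where
  "converges_in_probability M Y Z \<longleftrightarrow>
     (\<forall>e>0. (\<lambda>m. \<P>(\<omega> in M. dist (Y m \<omega>) (Z \<omega>) > e)) \<longlonglongrightarrow> 0)"

primrec affine_recursion ::
  "(nat \<Rightarrow> real) \<Rightarrow> real \<Rightarrow> (nat \<Rightarrow> 'a::real_vector) \<Rightarrow> nat \<Rightarrow> 'a" where
  "affine_recursion a b x 0 = 0"
| "affine_recursion a b x (Suc t) = a (Suc t) *\<^sub>R affine_recursion a b x t + b *\<^sub>R x (Suc t)"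

text \<open>The infimum is taken in \<^typ>\<open>enat\<close>, so it is \<open>\<infinity>\<close> if the set is never hit.\<close>

definition hitting_time :: "'a set \<Rightarrow> (nat \<Rightarrow> 'a) \<Rightarrow> enat" where
  "hitting_time S x = Inf {enat t | t. t \<ge> 1 \<and> x t \<in> S}"

end

theory Submission
  imports Defs
begin

text \<open>
  Put \<open>Y t = X t / \<beta>\<close> and \<open>S t = \<xi> 1 + \<dots> + \<xi> t\<close>. Over a fixed horizon \<open>j\<close>, \<open>Y\<close> is uniformly
  close to \<open>S\<close> as soon as \<open>\<alpha> 1, \<dots>, \<alpha> j\<close> are close to \<open>1\<close> and \<open>S\<close> is bounded, which for large \<open>m\<close>
  happens with probability near \<open>1\<close>. On this event, if \<open>S\<close> avoids the enlarged target
  \<open>\<rho> A + ball 0 \<epsilon>\<close> up to time \<open>j\<close>, then \<open>Y\<close> avoids \<open>(\<gamma> / \<beta>) A\<close>; so the tail of \<open>\<tau>\<close> at \<open>j\<close> is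
  asymptotically at least the tail of the hitting time \<open>T\<close> of \<open>S\<close>. Since \<open>E T = \<infinity>\<close>, the tails
  of \<open>T\<close> are all positive and have infinite sum.
\<close>

section \<open>Perturbation of the random walk by multipliers close to 1\<close>

lemma affine_recursion_scale:
  "affine_recursion a b x t = b *\<^sub>R affine_recursion a 1 x t"
  by (induction t) (simp_all add: scaleR_add_right mult.commute)

text \<open>The error e(t) obeys e(t+1) \<le> (1 + \<delta>) e(t) + \<delta> K with e(0) = 0, and
  the right-hand side of the claim is the solution of this recursion with equality. It vanishes as
  \<delta> tends to 0 with K and the horizon fixed.\<close>

lemma norm_affine_recursion_diff_sum_le:
  fixes x :: "nat \<Rightarrow> 'a::real_normed_vector"
  assumes a: "\<And>i. 1 \<le> i \<Longrightarrow> i \<le> j \<Longrightarrow> \<bar>a i - 1\<bar> \<le> \<delta>"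
    and K: "\<And>i. i \<le> j \<Longrightarrow> norm (\<Sum>k=1..i. x k) \<le> K"
    and "t \<le> j"
  shows "norm (affine_recursion a 1 x t - (\<Sum>k=1..t. x k)) \<le> K * ((1 + \<delta>) ^ t - 1)"
  using \<open>t \<le> j\<close>
proof (induction t)
  case 0
  then show ?case by simp
next
  case (Suc t)
  define D where "D = affine_recursion a 1 x t - (\<Sum>k=1..t. x k)"
  define S where "S = (\<Sum>k=1..t. x k)"
  have IH: "norm D \<le> K * ((1 + \<delta>) ^ t - 1)"
    unfolding D_def using Suc by simp
  have S: "norm S \<le> K" and d: "\<bar>a (Suc t) - 1\<bar> \<le> \<delta>"
    unfolding S_def using Suc.prems K[of t] a[of "Suc t"] by simp_all
  then have "\<bar>a (Suc t)\<bar> \<le> 1 + \<delta>" "0 \<le> \<delta>" by linarith+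
  \<comment> \<open>The increment \<open>x (Suc t)\<close> cancels; writing the recursion at time
    \<open>t\<close> as \<open>D + S\<close> separates the inherited error from the new one.\<close>
  have "affine_recursion a 1 x (Suc t) - (\<Sum>k=1..Suc t. x k)
      = a (Suc t) *\<^sub>R D + (a (Suc t) - 1) *\<^sub>R S"
    by (simp add: D_def S_def algebra_simps)
  then have "norm (affine_recursion a 1 x (Suc t) - (\<Sum>k=1..Suc t. x k))
      \<le> \<bar>a (Suc t)\<bar> * norm D + \<bar>a (Suc t) - 1\<bar> * norm S"
    using norm_triangle_ineq[of "a (Suc t) *\<^sub>R D" "(a (Suc t) - 1) *\<^sub>R S"] by simp
  also have "\<dots> \<le> (1 + \<delta>) * (K * ((1 + \<delta>) ^ t - 1)) + \<delta> * K"
    using IH S d \<open>\<bar>a (Suc t)\<bar> \<le> 1 + \<delta>\<close> \<open>0 \<le> \<delta>\<close> by (intro add_mono mult_mono) auto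
  also have "\<dots> = K * ((1 + \<delta>) ^ Suc t - 1)"
    by (simp add: algebra_simps)
  finally show ?case .
qed

section \<open>Tail events and measurability of hitting times\<close>

lemma less_hitting_time_iff:
  "enat j < hitting_time S x \<longleftrightarrow> (\<forall>t. 1 \<le> t \<and> t \<le> j \<longrightarrow> x t \<notin> S)"
proof
  assume j: "enat j < hitting_time S x"
  show "\<forall>t. 1 \<le> t \<and> t \<le> j \<longrightarrow> x t \<notin> S"
  proof (intro allI impI notI)
    fix t assume "1 \<le> t \<and> t \<le> j" "x t \<in> S"
    then have "hitting_time S x \<le> enat t"
      unfolding hitting_time_def by (intro Inf_lower) auto
    with j have "enat j < enat t" by (rule less_le_trans)
    with \<open>1 \<le> t \<and> t \<le> j\<close> show False by simp
  qed
next
  assume avoid: "\<forall>t. 1 \<le> t \<and> t \<le> j \<longrightarrow> x t \<notin> S"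
  \<comment> \<open>A lower bound for an infimum is only weak, so strictness comes from passing to
    the successor. An empty set of hitting times is covered too.\<close>
  have "enat (Suc j) \<le> hitting_time S x"
    unfolding hitting_time_def
  proof (rule Inf_greatest)
    fix z assume "z \<in> {enat t | t. 1 \<le> t \<and> x t \<in> S}"
    then obtain t where "z = enat t" "1 \<le> t" "x t \<in> S" by auto
    with avoid have "\<not> t \<le> j" by blast
    with \<open>z = enat t\<close> show "enat (Suc j) \<le> z" by simp
  qed
  then show "enat j < hitting_time S x" by (simp add: Suc_ile_eq)
qed

text \<open>As \<open>enat\<close> is countable, singletons suffice: a finite value is a difference
  of two consecutive tail events (the complement of one tail at 0), and the value \<infinity> is the
  intersection of all tails.\<close>

lemma measurable_enatI:
  fixes f :: "'a \<Rightarrow> enat"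
  assumes [measurable]: "\<And>j. Measurable.pred M (\<lambda>x. enat j < f x)"
  shows "f \<in> measurable M (count_space UNIV)"
  unfolding measurable_count_space_eq2_countable
proof safe
  fix a :: enat
  have "Measurable.pred M (\<lambda>x. f x = a)"
  proof (cases a)
    case (enat n)
    show ?thesis
    proof (cases n)
      case 0
      then have "(\<lambda>x. f x = a) = (\<lambda>x. \<not> enat 0 < f x)"
        using enat by (auto simp: zero_enat_def[symmetric])
      then show ?thesis by simp
    next
      case (Suc k)
      have "(\<lambda>x. f x = a) = (\<lambda>x. enat k < f x \<and> \<not> enat (Suc k) < f x)"
      proof
        fix x
        show "(f x = a) = (enat k < f x \<and> \<not> enat (Suc k) < f x)"
          using enat Suc by (cases "f x") auto
      qed
      then show ?thesis by simp
    qed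
  next
    case infinity
    have "(\<lambda>x. f x = a) = (\<lambda>x. \<forall>j. enat j < f x)"
    proof
      fix x
      show "(f x = a) = (\<forall>j. enat j < f x)"
        using infinity by (cases "f x") auto
    qed
    then show ?thesis by simp
  qed
  then show "f -` {a} \<inter> space M \<in> sets M"
    by (simp add: pred_def vimage_def Int_def conj_commute)
qed simp

lemma pred_less_hitting_time:
  assumes "\<And>t. 1 \<le> t \<Longrightarrow> x t \<in> borel_measurable M" and "S \<in> sets borel"
  shows "Measurable.pred M (\<lambda>\<omega>. enat j < hitting_time S (\<lambda>t. x t \<omega>))"
proof -
  have "Measurable.pred M (\<lambda>\<omega>. x t \<omega> \<in> S)" if "1 \<le> t" for t
    using assms that by measurable
  then have "Measurable.pred M (\<lambda>\<omega>. \<forall>t\<in>{1..j}. x t \<omega> \<notin> S)"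
    by (intro pred_intros_finite pred_intros_logic) auto
  also have "(\<lambda>\<omega>. \<forall>t\<in>{1..j}. x t \<omega> \<notin> S) = (\<lambda>\<omega>. enat j < hitting_time S (\<lambda>t. x t \<omega>))"
    by (auto simp: less_hitting_time_iff)
  finally show ?thesis .
qed

section \<open>Choice of the constants and geometry of the enlarged target\<close>

lemma (in prob_space) exists_prob_greater_less:
  fixes Z :: "'a \<Rightarrow> real"
  assumes [measurable]: "Z \<in> borel_measurable M" and "0 < \<eta>"
  shows "\<exists>K. \<P>(\<omega> in M. Z \<omega> > K) < \<eta>"
proof -
  \<comment> \<open>Continuity from above: the events decrease to the empty set because
    \<open>Z\<close> is real-valued.\<close>
  have "(\<lambda>n. \<P>(\<omega> in M. Z \<omega> > real n)) \<longlonglongrightarrow> prob (\<Inter>n. {\<omega>\<in>space M. Z \<omega> > real n})"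
    by (intro finite_Lim_measure_decseq) (auto simp: decseq_def)
  moreover have "(\<Inter>n. {\<omega>\<in>space M. Z \<omega> > real n}) = {}"
  proof -
    have "\<exists>n. \<not> Z \<omega> > real n" for \<omega>
      using real_arch_simple[of "Z \<omega>"] by (auto simp: not_less)
    then show ?thesis by blast
  qed
  ultimately have "(\<lambda>n. \<P>(\<omega> in M. Z \<omega> > real n)) \<longlonglongrightarrow> 0" by simp
  then have "\<forall>\<^sub>F n in sequentially. \<P>(\<omega> in M. Z \<omega> > real n) < \<eta>"
    using \<open>0 < \<eta>\<close> by (rule order_tendstoD)
  then show ?thesis
    by (auto simp: eventually_sequentially)
qed

text \<open>The expression is continuous in \<delta> and vanishes at 0. Thus the tolerance \<delta>
  for the multipliers can be chosen after the bound K and the horizon j.\<close>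

lemma exists_growth_factor:
  assumes "0 < (\<epsilon>::real)"
  shows "\<exists>\<delta>>0. K * ((1 + \<delta>) ^ j - 1) < \<epsilon>"
proof -
  have "((\<lambda>\<delta>. K * ((1 + \<delta>) ^ j - 1)) \<longlongrightarrow> K * ((1 + 0) ^ j - 1)) (at_right 0)"
    by (intro tendsto_intros)
  then have "\<forall>\<^sub>F \<delta> in at_right 0. K * ((1 + \<delta>) ^ j - 1) < \<epsilon>"
    using assms by (intro order_tendstoD) auto
  then have "\<forall>\<^sub>F \<delta> in at_right 0. 0 < \<delta> \<and> K * ((1 + \<delta>) ^ j - 1) < \<epsilon>"
    by (intro eventually_conj eventually_at_right_less)
  then show ?thesis
    by (rule eventually_happens'[rotated]) simp
qed

text \<open>The radius is split in two halves: one pays for replacing the factor c by \<rho>, the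
  other for the distance from \<open>c *\<^sub>R a\<close> to z. It is applied with c =
  \<gamma>/\<beta>, z the random walk, and \<open>c *\<^sub>R a\<close> the rescaled recursion at a
  hit.\<close>

lemma mem_scaled_plus_ball:
  fixes a y z :: "'a::real_normed_vector"
  assumes "a \<in> A" "norm a \<le> R" and "\<bar>c - \<rho>\<bar> * R < \<epsilon> / 2" and "norm (c *\<^sub>R a - z) < \<epsilon> / 2"
  shows "z \<in> (\<lambda>a. \<rho> *\<^sub>R a) ` A + ball 0 \<epsilon>"
proof -
  have "norm ((c - \<rho>) *\<^sub>R a) \<le> \<bar>c - \<rho>\<bar> * R"
    using assms(2) by (simp add: mult_left_mono)
  then have "norm ((c - \<rho>) *\<^sub>R a - (c *\<^sub>R a - z)) < \<epsilon>"
    using norm_triangle_ineq4[of "(c - \<rho>) *\<^sub>R a" "c *\<^sub>R a - z"] assms(3,4) by linarith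
  also have "(c - \<rho>) *\<^sub>R a - (c *\<^sub>R a - z) = z - \<rho> *\<^sub>R a"
    by (simp add: algebra_simps)
  finally have "z - \<rho> *\<^sub>R a \<in> ball 0 \<epsilon>" by simp
  then have "\<rho> *\<^sub>R a + (z - \<rho> *\<^sub>R a) \<in> (\<lambda>a. \<rho> *\<^sub>R a) ` A + ball 0 \<epsilon>"
    using \<open>a \<in> A\<close> by (intro set_plus_intro) auto
  then show ?thesis by simp
qed

section \<open>Comparison of the two tails at a fixed horizon\<close>

lemma borel_measurable_affine_recursion:
  fixes \<xi> :: "nat \<Rightarrow> 'w \<Rightarrow> 'b::euclidean_space"
  assumes "\<And>t. 1 \<le> t \<Longrightarrow> \<alpha> t \<in> borel_measurable M"
    and "\<And>t. 1 \<le> t \<Longrightarrow> \<xi> t \<in> borel_measurable M"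
  shows "(\<lambda>\<omega>. affine_recursion (\<lambda>i. \<alpha> i \<omega>) b (\<lambda>i. \<xi> i \<omega>) t) \<in> borel_measurable M"
proof (induction t)
  case (Suc t)
  have "\<alpha> (Suc t) \<in> borel_measurable M" "\<xi> (Suc t) \<in> borel_measurable M"
    using assms by simp_all
  with Suc show ?case by simp
qed simp

lemma scaleR_image_borel:
  fixes A :: "'b::real_normed_vector set"
  assumes "A \<in> sets borel" and "c \<noteq> 0"
  shows "(\<lambda>a. c *\<^sub>R a) ` A \<in> sets borel"
proof -
  have "(\<lambda>a. c *\<^sub>R a) ` A = (\<lambda>x. inverse c *\<^sub>R x) -` A \<inter> space borel"
    using \<open>c \<noteq> 0\<close> by (auto intro!: image_eqI)
  also have "\<dots> \<in> sets borel"
    using assms(1) by (intro measurable_sets[of _ borel borel] borel_measurable_continuous_onI)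
      (auto intro!: continuous_intros)
  finally show ?thesis .
qed

text \<open>For large m the event \<open>E\<close> is covered by \<open>F m\<close> and two kinds of
  bad event: the walk is large (\<open>C\<close>), or some multiplier up to time j is far from 1
  (\<open>B m t\<close>). Tightness keeps the first below \<eta>/2, convergence in probability the
  total of the others, and a union bound concludes.\<close>

lemma (in prob_space) eventually_prob_hitting_time_ge:
  fixes \<xi> :: "nat \<Rightarrow> 'a \<Rightarrow> 'b::euclidean_space" and \<alpha> :: "nat \<Rightarrow> nat \<Rightarrow> 'a \<Rightarrow> real"
  assumes \<xi>: "\<And>t. 1 \<le> t \<Longrightarrow> \<xi> t \<in> borel_measurable M"
    and \<alpha>: "\<And>m t. 1 \<le> t \<Longrightarrow> \<alpha> m t \<in> borel_measurable M"
    and conv: "\<And>t. 1 \<le> t \<Longrightarrow> converges_in_probability M (\<lambda>m. \<alpha> m t) (\<lambda>_. 1)"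
    and \<beta>: "\<And>m. \<beta> m > 0" and \<gamma>: "\<And>m. \<gamma> m > 0"
    and A: "A \<in> sets borel" "bounded A"
    and lim: "(\<lambda>m. \<gamma> m / \<beta> m) \<longlonglongrightarrow> \<rho>"
    and \<epsilon>: "0 < \<epsilon>" and \<eta>: "0 < \<eta>"
  shows "\<forall>\<^sub>F m in sequentially.
    \<P>(\<omega> in M. enat j < hitting_time ((\<lambda>a. \<rho> *\<^sub>R a) ` A + ball 0 \<epsilon>) (\<lambda>t. \<Sum>i=1..t. \<xi> i \<omega>)) - \<eta>
    \<le> \<P>(\<omega> in M. enat j < hitting_time ((\<lambda>a. \<gamma> m *\<^sub>R a) ` A)
          (affine_recursion (\<lambda>i. \<alpha> m i \<omega>) (\<beta> m) (\<lambda>i. \<xi> i \<omega>)))"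
proof -
  define S where "S t \<omega> = (\<Sum>i=1..t. \<xi> i \<omega>)" for t \<omega>
  \<comment> \<open>The sum dominates each \<open>norm (S t \<omega>)\<close> with t \<le> j, so one
    bound on \<open>Z\<close> controls the whole path.\<close>
  define Z where "Z \<omega> = (\<Sum>t\<le>j. norm (S t \<omega>))" for \<omega>
  have S_meas [measurable]: "S t \<in> borel_measurable M" for t
    unfolding S_def using \<xi> by (intro borel_measurable_sum) auto
  have Z_meas [measurable]: "Z \<in> borel_measurable M"
    unfolding Z_def by measurable
  obtain K where K: "\<P>(\<omega> in M. Z \<omega> > K) < \<eta> / 2"
    using exists_prob_greater_less[of Z "\<eta> / 2"] \<eta> by auto
  \<comment> \<open>\<open>max K 0\<close> is used because the tightness bound K may be negative,
    while a nonnegative factor is needed to replace the power t by j.\<close>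
  obtain \<delta> where \<delta>: "0 < \<delta>" "max K 0 * ((1 + \<delta>) ^ j - 1) < \<epsilon> / 2"
    using exists_growth_factor[of "\<epsilon> / 2"] \<epsilon> by auto
  obtain R where R: "0 < R" "\<And>a. a \<in> A \<Longrightarrow> norm a \<le> R"
    using A(2) unfolding bounded_pos by auto
  define E where "E = {\<omega> \<in> space M. enat j < hitting_time ((\<lambda>a. \<rho> *\<^sub>R a) ` A + ball 0 \<epsilon>) (\<lambda>t. S t \<omega>)}"
  define F where "F m = {\<omega> \<in> space M. enat j < hitting_time ((\<lambda>a. \<gamma> m *\<^sub>R a) ` A)
    (affine_recursion (\<lambda>i. \<alpha> m i \<omega>) (\<beta> m) (\<lambda>i. \<xi> i \<omega>))}" for m
  define B where "B m t = {\<omega> \<in> space M. dist (\<alpha> m t \<omega>) 1 > \<delta>}" for m t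
  define C where "C = {\<omega> \<in> space M. Z \<omega> > K}"
  have F_sets: "F m \<in> sets M" for m
    unfolding F_def
    using \<gamma>[of m] A(1)
    by (intro predE pred_less_hitting_time borel_measurable_affine_recursion \<alpha> \<xi>
        scaleR_image_borel) auto
  have B_sets: "B m t \<in> sets M" if "1 \<le> t" for m t
  proof -
    have [measurable]: "\<alpha> m t \<in> borel_measurable M" using that by (rule \<alpha>)
    show ?thesis unfolding B_def by measurable
  qed
  have C_sets: "C \<in> sets M" unfolding C_def by measurable
  have cover: "E \<subseteq> F m \<union> (C \<union> (\<Union>t\<in>{1..j}. B m t))" if m: "\<bar>\<gamma> m / \<beta> m - \<rho>\<bar> * R < \<epsilon> / 2" for m
  proof
    fix \<omega> assume \<omega>: "\<omega> \<in> E"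
    show "\<omega> \<in> F m \<union> (C \<union> (\<Union>t\<in>{1..j}. B m t))"
    proof (rule ccontr)
      assume "\<omega> \<notin> F m \<union> (C \<union> (\<Union>t\<in>{1..j}. B m t))"
      with \<omega> have nF: "\<omega> \<notin> F m" and ZK: "Z \<omega> \<le> K"
        and \<alpha>1: "\<And>t. 1 \<le> t \<Longrightarrow> t \<le> j \<Longrightarrow> \<bar>\<alpha> m t \<omega> - 1\<bar> \<le> \<delta>" and sp: "\<omega> \<in> space M"
        by (auto simp: E_def C_def B_def dist_real_def not_less)
      have SK: "norm (S t \<omega>) \<le> max K 0" if "t \<le> j" for t
        using member_le_sum[of t "{..j}" "\<lambda>t. norm (S t \<omega>)"] that ZK by (auto simp: Z_def)
      \<comment> \<open>Outside \<open>F m\<close> the recursion hits its target by time j; the walk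
        is then shown to hit the enlarged target at the same t, contradicting
        \<open>E\<close>.\<close>
      from nF sp obtain t where t: "1 \<le> t" "t \<le> j"
        and "affine_recursion (\<lambda>i. \<alpha> m i \<omega>) (\<beta> m) (\<lambda>i. \<xi> i \<omega>) t \<in> (\<lambda>a. \<gamma> m *\<^sub>R a) ` A"
        unfolding F_def by (auto simp: less_hitting_time_iff)
      then obtain a where a: "a \<in> A"
        and X: "affine_recursion (\<lambda>i. \<alpha> m i \<omega>) (\<beta> m) (\<lambda>i. \<xi> i \<omega>) t = \<gamma> m *\<^sub>R a"
        by blast
      from X have "\<beta> m *\<^sub>R affine_recursion (\<lambda>i. \<alpha> m i \<omega>) 1 (\<lambda>i. \<xi> i \<omega>) t = \<gamma> m *\<^sub>R a"
        by (rule trans[OF affine_recursion_scale[symmetric]])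
      then have Y: "affine_recursion (\<lambda>i. \<alpha> m i \<omega>) 1 (\<lambda>i. \<xi> i \<omega>) t = (\<gamma> m / \<beta> m) *\<^sub>R a"
        using \<beta>[of m] by - (rule real_vector.scale_left_imp_eq[of "\<beta> m"], simp_all)
      have "norm ((\<gamma> m / \<beta> m) *\<^sub>R a - S t \<omega>) \<le> max K 0 * ((1 + \<delta>) ^ t - 1)"
        using norm_affine_recursion_diff_sum_le[of j "\<lambda>i. \<alpha> m i \<omega>" \<delta> "\<lambda>i. \<xi> i \<omega>" "max K 0" t]
          \<alpha>1 SK t(2) by (simp add: S_def Y)
      also have "\<dots> \<le> max K 0 * ((1 + \<delta>) ^ j - 1)"
        using t(2) \<delta>(1) by (intro mult_left_mono diff_right_mono power_increasing) auto
      finally have "norm ((\<gamma> m / \<beta> m) *\<^sub>R a - S t \<omega>) < \<epsilon> / 2"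
        using \<delta>(2) by simp
      then have "S t \<omega> \<in> (\<lambda>a. \<rho> *\<^sub>R a) ` A + ball 0 \<epsilon>"
        by (rule mem_scaled_plus_ball[OF a R(2)[OF a] m])
      with \<omega> t show False by (auto simp: E_def less_hitting_time_iff)
    qed
  qed
  \<comment> \<open>Since R bounds the norm on \<open>A\<close>, this controls the change of scale
    for all points of \<open>A\<close> at once.\<close>
  have "((\<lambda>m. \<bar>\<gamma> m / \<beta> m - \<rho>\<bar> * R) \<longlongrightarrow> \<bar>\<rho> - \<rho>\<bar> * R) sequentially"
    by (intro tendsto_intros lim)
  then have ev1: "\<forall>\<^sub>F m in sequentially. \<bar>\<gamma> m / \<beta> m - \<rho>\<bar> * R < \<epsilon> / 2"
    using \<epsilon> by (intro order_tendstoD) auto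
  have "((\<lambda>m. \<Sum>t\<in>{1..j}. prob (B m t)) \<longlongrightarrow> (\<Sum>t\<in>{1..j}. 0)) sequentially"
    using conv \<delta>(1) unfolding B_def converges_in_probability_def by (intro tendsto_sum) auto
  then have ev2: "\<forall>\<^sub>F m in sequentially. (\<Sum>t\<in>{1..j}. prob (B m t)) < \<eta> / 2"
    using \<eta> by (intro order_tendstoD) auto
  have "\<forall>\<^sub>F m in sequentially. prob E - \<eta> \<le> prob (F m)"
    using ev1 ev2
  proof eventually_elim
    case (elim m)
    have U_sets: "(\<Union>t\<in>{1..j}. B m t) \<in> sets M" using B_sets by auto
    have "prob E \<le> prob (F m \<union> (C \<union> (\<Union>t\<in>{1..j}. B m t)))"
      using cover[OF elim(1)] F_sets C_sets U_sets by (intro finite_measure_mono) auto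
    also have "\<dots> \<le> prob (F m) + prob (C \<union> (\<Union>t\<in>{1..j}. B m t))"
      using F_sets C_sets U_sets by (intro measure_Un_le) auto
    also have "prob (C \<union> (\<Union>t\<in>{1..j}. B m t)) \<le> prob C + prob (\<Union>t\<in>{1..j}. B m t)"
      using C_sets U_sets by (intro measure_Un_le) auto
    also have "prob (\<Union>t\<in>{1..j}. B m t) \<le> (\<Sum>t\<in>{1..j}. prob (B m t))"
      using B_sets by (intro measure_UNION_le) auto
    finally show ?case using elim(2) K by (simp add: C_def)
  qed
  then show ?thesis by (simp add: E_def F_def S_def)
qed

section \<open>Expectations as series of tail probabilities\<close>

lemma (in prob_space) nn_integral_enat_eq_suminf_prob:
  assumes "f \<in> measurable M (count_space UNIV)"
  shows "(\<integral>\<^sup>+\<omega>. ennreal_of_enat (f \<omega>) \<partial>M) = (\<Sum>j. ennreal (\<P>(\<omega> in M. enat j < f \<omega>)))"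
  using nn_integral_enat_function[OF assms] by (simp add: emeasure_eq_measure)

text \<open>A null tail at j would make f at most j almost everywhere, hence its mean at most
  j.\<close>

lemma (in prob_space) prob_less_pos_of_nn_integral_infinite:
  assumes f: "f \<in> measurable M (count_space UNIV)"
    and inf: "(\<integral>\<^sup>+\<omega>. ennreal_of_enat (f \<omega>) \<partial>M) = \<infinity>"
  shows "0 < \<P>(\<omega> in M. enat j < f \<omega>)"
proof (rule ccontr)
  assume "\<not> 0 < \<P>(\<omega> in M. enat j < f \<omega>)"
  then have "\<P>(\<omega> in M. enat j < f \<omega>) = 0"
    using measure_nonneg by (simp add: not_less antisym)
  moreover have "{\<omega> \<in> space M. enat j < f \<omega>} \<in> events"
    using f by measurable
  ultimately have "AE \<omega> in M. \<not> enat j < f \<omega>"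
    by (simp add: prob_eq_0)
  then have "AE \<omega> in M. ennreal_of_enat (f \<omega>) \<le> of_nat j"
  proof eventually_elim
    case (elim \<omega>)
    then show ?case by (cases "f \<omega>") auto
  qed
  then have "(\<integral>\<^sup>+\<omega>. ennreal_of_enat (f \<omega>) \<partial>M) \<le> (\<integral>\<^sup>+\<omega>. of_nat j \<partial>M)"
    by (rule nn_integral_mono_AE)
  also have "\<dots> = of_nat j" by (simp add: emeasure_space_1)
  finally have "(\<integral>\<^sup>+\<omega>. ennreal_of_enat (f \<omega>) \<partial>M) \<le> of_nat j" .
  then show False using inf by (simp add: top_unique)
qed

text \<open>A Fatou-type argument: a finite partial sum of the \<open>p j\<close> is already large,
  and only finitely many asymptotic lower bounds are needed to carry it over to
  \<open>q m\<close>.\<close>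

lemma suminf_ennreal_tendsto_top:
  fixes p :: "nat \<Rightarrow> real" and q :: "nat \<Rightarrow> nat \<Rightarrow> real"
  assumes inf: "(\<Sum>j. ennreal (p j)) = \<infinity>"
    and p: "\<And>j. 0 \<le> p j" and q: "\<And>m j. 0 \<le> q m j"
    and ge: "\<And>j \<eta>. 0 < \<eta> \<Longrightarrow> \<forall>\<^sub>F m in sequentially. p j - \<eta> \<le> q m j"
  shows "(\<lambda>m. \<Sum>j. ennreal (q m j)) \<longlonglongrightarrow> \<infinity>"
proof -
  have "\<forall>\<^sub>F m in sequentially. ennreal c < (\<Sum>j. ennreal (q m j))" if "0 \<le> c" for c
  proof -
    have "(\<lambda>J. \<Sum>j<J. ennreal (p j)) \<longlonglongrightarrow> top"
      using summable_LIMSEQ[of "\<lambda>j. ennreal (p j)"] inf by simp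
    \<comment> \<open>The surplus 1 above c pays for the total loss of at most 1 from the J
      terms.\<close>
    then have "\<forall>\<^sub>F J in sequentially. ennreal (c + 1) < (\<Sum>j<J. ennreal (p j))"
      by (rule order_tendstoD) simp
    then obtain J where "ennreal (c + 1) < (\<Sum>j<J. ennreal (p j))"
      by (auto simp: eventually_sequentially)
    then have J: "c + 1 < (\<Sum>j<J. p j)"
      using that p by (simp add: sum_ennreal ennreal_less_iff del: ennreal_plus)
    \<comment> \<open>J losses of this size add up to at most 1, and the denominator stays positive
      when J = 0.\<close>
    define \<eta> where "\<eta> = 1 / (real J + 1)"
    have \<eta>: "0 < \<eta>" "real J * \<eta> \<le> 1" by (auto simp: \<eta>_def field_simps)
    have "\<forall>\<^sub>F m in sequentially. \<forall>j\<in>{..<J}. p j - \<eta> \<le> q m j"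
      using ge[OF \<eta>(1)] by (intro eventually_ball_finite) auto
    then show ?thesis
    proof eventually_elim
      case (elim m)
      have "(\<Sum>j<J. p j) - real J * \<eta> = (\<Sum>j<J. p j - \<eta>)"
        by (simp add: sum_subtractf)
      also have "\<dots> \<le> (\<Sum>j<J. q m j)"
        using elim by (intro sum_mono) auto
      finally have "c < (\<Sum>j<J. q m j)" using J \<eta>(2) by linarith
      then have "ennreal c < (\<Sum>j<J. ennreal (q m j))"
        using that q by (simp add: sum_ennreal ennreal_less_iff)
      also have "\<dots> \<le> (\<Sum>j. ennreal (q m j))"
        by (intro sum_le_suminf) auto
      finally show ?case .
    qed
  qed
  then show ?thesis
    by (simp add: tendsto_top_iff_ennreal)
qed

section \<open>Transfer to the i.i.d. copies and conclusion\<close>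

lemma iid_copies_measurable:
  assumes "prob_space M" "iid_copies M Y Z" "1 \<le> t"
  shows "Y t \<in> borel_measurable M"
  using assms prob_space.indep_vars_def2[of M "\<lambda>_. borel" Y "{1..}"]
  by (auto simp: iid_copies_def)

text \<open>Convergence in probability to a constant depends only on the laws of the individual
  variables, which copies share.\<close>

lemma iid_copies_converges_in_probability:
  fixes Y :: "nat \<Rightarrow> nat \<Rightarrow> 'w \<Rightarrow> real"
  assumes M: "prob_space M"
    and iid: "\<And>m. iid_copies M (Y m) (Y\<^sub>0 m)" and "1 \<le> t"
    and Y0: "\<And>m. Y\<^sub>0 m \<in> borel_measurable M"
    and conv: "converges_in_probability M Y\<^sub>0 (\<lambda>_. c)"
  shows "converges_in_probability M (\<lambda>m. Y m t) (\<lambda>_. c)"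
proof -
  have "\<P>(\<omega> in M. dist (Y m t \<omega>) c > e) = \<P>(\<omega> in M. dist (Y\<^sub>0 m \<omega>) c > e)" for m e
  proof -
    have D: "{y. dist y c > e} \<in> sets borel" by measurable
    have Y: "Y m t \<in> borel_measurable M"
      using M iid \<open>1 \<le> t\<close> by (rule iid_copies_measurable)
    have "\<P>(\<omega> in M. dist (Y m t \<omega>) c > e) = measure (distr M borel (Y m t)) {y. dist y c > e}"
      using D Y by (subst measure_distr) (auto intro!: arg_cong[where f = "measure M"])
    also have "distr M borel (Y m t) = distr M borel (Y\<^sub>0 m)"
      using iid \<open>1 \<le> t\<close> by (simp add: iid_copies_def)
    also have "measure \<dots> {y. dist y c > e} = \<P>(\<omega> in M. dist (Y\<^sub>0 m \<omega>) c > e)"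
      using D Y0 by (subst measure_distr) (auto intro!: arg_cong[where f = "measure M"])
    finally show ?thesis .
  qed
  with conv show ?thesis by (simp add: converges_in_probability_def)
qed

theorem theorem2p3:
  fixes M :: "'w measure"
    and \<xi>\<^sub>0 :: "'w \<Rightarrow> real ^ 'd"
    and \<xi> :: "nat \<Rightarrow> 'w \<Rightarrow> real ^ 'd"
    and \<alpha>\<^sub>0 :: "nat \<Rightarrow> 'w \<Rightarrow> real"
    and \<alpha> :: "nat \<Rightarrow> nat \<Rightarrow> 'w \<Rightarrow> real"
    and \<beta> \<gamma> :: "nat \<Rightarrow> real"
    and A :: "(real ^ 'd) set"
    and r R \<rho> :: real
    and X :: "nat \<Rightarrow> nat \<Rightarrow> 'w \<Rightarrow> real ^ 'd"
    and \<tau> :: "nat \<Rightarrow> 'w \<Rightarrow> enat"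
  defines "X \<equiv> \<lambda>m t \<omega>. affine_recursion (\<lambda>i. \<alpha> m i \<omega>) (\<beta> m) (\<lambda>i. \<xi> i \<omega>) t"
    and "\<tau> \<equiv> \<lambda>m \<omega>. hitting_time ((\<lambda>a. \<gamma> m *\<^sub>R a) ` A) (\<lambda>t. X m t \<omega>)"
  assumes "prob_space M"
    and "\<And>m. \<alpha>\<^sub>0 m \<in> borel_measurable M"
    and "\<And>m. AE \<omega> in M. \<alpha>\<^sub>0 m \<omega> > 0"
    and "\<And>m. integrable M (\<alpha>\<^sub>0 m)"
    and "\<And>m. integrable M (\<lambda>\<omega>. (\<alpha>\<^sub>0 m \<omega>)\<^sup>2)"
    and "\<And>m. \<beta> m > 0"
    and "\<And>m. \<gamma> m > 0"
    and "A \<in> sets borel"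
    and "r > 0" and "R > 0"
    and "ball 0 r \<subseteq> A" and "A \<subseteq> ball 0 R"
    and "\<xi>\<^sub>0 \<in> borel_measurable M"
    and "iid_copies M \<xi> \<xi>\<^sub>0"
    and "\<And>m. iid_copies M (\<alpha> m) (\<alpha>\<^sub>0 m)"
    and "\<And>m. indep_sequences M (\<alpha> m) \<xi>"
    and "converges_in_probability M \<alpha>\<^sub>0 (\<lambda>_. 1)"
    and "\<rho> \<ge> 0"
    and "(\<lambda>m. \<gamma> m / \<beta> m) \<longlonglongrightarrow> \<rho>"
    and "\<exists>\<epsilon>>0. (\<integral>\<^sup>+\<omega>. ennreal_of_enat
           (hitting_time ((\<lambda>a. \<rho> *\<^sub>R a) ` A + ball 0 \<epsilon>) (\<lambda>t. \<Sum>i=1..t. \<xi> i \<omega>)) \<partial>M) = \<infinity>"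
  shows "(\<forall>j::nat. liminf (\<lambda>m. ereal (\<P>(\<omega> in M. \<tau> m \<omega> > enat j))) > 0)
         \<and> (\<lambda>m. \<integral>\<^sup>+\<omega>. ennreal_of_enat (\<tau> m \<omega>) \<partial>M) \<longlonglongrightarrow> \<infinity>"
proof -
  interpret prob_space M by fact
  have \<xi>_meas: "\<xi> t \<in> borel_measurable M" if "1 \<le> t" for t
    using assms(3) \<open>iid_copies M \<xi> \<xi>\<^sub>0\<close> that by (rule iid_copies_measurable)
  have \<alpha>_meas: "\<alpha> m t \<in> borel_measurable M" if "1 \<le> t" for m t
    using assms(3) \<open>\<And>m. iid_copies M (\<alpha> m) (\<alpha>\<^sub>0 m)\<close> that by (rule iid_copies_measurable)
  have \<alpha>_conv: "converges_in_probability M (\<lambda>m. \<alpha> m t) (\<lambda>_. 1)" if "1 \<le> t" for t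
    using assms(3) \<open>\<And>m. iid_copies M (\<alpha> m) (\<alpha>\<^sub>0 m)\<close> that
      \<open>\<And>m. \<alpha>\<^sub>0 m \<in> borel_measurable M\<close> \<open>converges_in_probability M \<alpha>\<^sub>0 (\<lambda>_. 1)\<close>
    by (rule iid_copies_converges_in_probability)
  have "bounded A"
    using \<open>A \<subseteq> ball 0 R\<close> bounded_ball by (rule bounded_subset[rotated])
  obtain \<epsilon> where \<epsilon>: "0 < \<epsilon>" and infinite_mean: "(\<integral>\<^sup>+\<omega>. ennreal_of_enat
      (hitting_time ((\<lambda>a. \<rho> *\<^sub>R a) ` A + ball 0 \<epsilon>) (\<lambda>t. \<Sum>i=1..t. \<xi> i \<omega>)) \<partial>M) = \<infinity>"
    using assms(22) by blast
  define T where
    "T \<omega> = hitting_time ((\<lambda>a. \<rho> *\<^sub>R a) ` A + ball 0 \<epsilon>) (\<lambda>t. \<Sum>i=1..t. \<xi> i \<omega>)" for \<omega>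
  define p where "p j = \<P>(\<omega> in M. enat j < T \<omega>)" for j
  define q where "q m j = \<P>(\<omega> in M. enat j < \<tau> m \<omega>)" for m j
  \<comment> \<open>A sum with an open ball is open, hence Borel. This covers \<rho> = 0, which
    \<open>scaleR_image_borel\<close> excludes.\<close>
  have "(\<lambda>a. \<rho> *\<^sub>R a) ` A + ball 0 \<epsilon> = (\<Union>x\<in>(\<lambda>a. \<rho> *\<^sub>R a) ` A. \<Union>y\<in>ball 0 \<epsilon>. {x + y})"
    by (auto simp: set_plus_def)
  then have "open ((\<lambda>a. \<rho> *\<^sub>R a) ` A + ball 0 \<epsilon>)"
    using open_sums[OF disjI2[OF open_ball]] by (rule ssubst)
  then have T_meas: "T \<in> measurable M (count_space UNIV)"
    unfolding T_def using \<xi>_meas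
    by (intro measurable_enatI pred_less_hitting_time borel_measurable_sum) auto
  have \<tau>_meas: "\<tau> m \<in> measurable M (count_space UNIV)" for m
    unfolding \<tau>_def X_def using \<open>\<And>m. \<gamma> m > 0\<close>[of m] \<open>A \<in> sets borel\<close>
    by (intro measurable_enatI pred_less_hitting_time borel_measurable_affine_recursion
        \<alpha>_meas \<xi>_meas scaleR_image_borel) auto
  have ge: "\<forall>\<^sub>F m in sequentially. p j - \<eta> \<le> q m j" if "0 < \<eta>" for j \<eta>
    using eventually_prob_hitting_time_ge[of \<xi> \<alpha> \<beta> \<gamma> A \<rho> \<epsilon> \<eta> j, OF \<xi>_meas \<alpha>_meas \<alpha>_conv
        \<open>\<And>m. \<beta> m > 0\<close> \<open>\<And>m. \<gamma> m > 0\<close> \<open>A \<in> sets borel\<close> \<open>bounded A\<close> assms(21) \<epsilon> that]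
    by (simp add: p_def q_def T_def \<tau>_def X_def)
  have mean: "(\<integral>\<^sup>+\<omega>. ennreal_of_enat (T \<omega>) \<partial>M) = \<infinity>"
    using infinite_mean by (simp add: T_def)
  have "0 < liminf (\<lambda>m. ereal (q m j))" for j
  proof -
    have "0 < p j"
      unfolding p_def using T_meas mean by (rule prob_less_pos_of_nn_integral_infinite)
    \<comment> \<open>Allowing a loss of half of the positive tail \<open>p j\<close> leaves a
      positive lower bound independent of m.\<close>
    then have "\<forall>\<^sub>F m in sequentially. ereal (p j / 2) \<le> ereal (q m j)"
      using ge[of "p j / 2" j] by (auto elim!: eventually_mono)
    then have "ereal (p j / 2) \<le> liminf (\<lambda>m. ereal (q m j))"
      by (rule Liminf_bounded)
    moreover have "0 < ereal (p j / 2)" using \<open>0 < p j\<close> by simp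
    ultimately show ?thesis by (rule less_le_trans[rotated])
  qed
  moreover have "(\<Sum>j. ennreal (p j)) = \<infinity>"
    using nn_integral_enat_eq_suminf_prob[OF T_meas] mean by (simp add: p_def)
  then have "(\<lambda>m. \<Sum>j. ennreal (q m j)) \<longlonglongrightarrow> \<infinity>"
    using ge by (intro suminf_ennreal_tendsto_top) (auto simp: p_def q_def)
  then have "(\<lambda>m. \<integral>\<^sup>+\<omega>. ennreal_of_enat (\<tau> m \<omega>) \<partial>M) \<longlonglongrightarrow> \<infinity>"
    using nn_integral_enat_eq_suminf_prob[OF \<tau>_meas] by (simp add: q_def)
  ultimately show ?thesis by (simp add: q_def)
qed

end
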